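(* Let $R$ be a ring with $1\neq 0$, let $\Lambda$ be a set, and let $\Delta\subseteq\Lambda\times\Lambda$ satisfy axioms (A1) and (A2). Let $\Gamma$ be a normal subset of $\Delta$. Then $$G(\Delta)/G(\Gamma)\cong G(\Delta\setminus\Gamma).$$
   Context: Rings are associative and unital, not necessarily commutative. For a subset $\Delta\subseteq\Lambda\times\Lambda$ the axioms are: (A1) $(i,i)\notin\Delta$ for all $i\in\Lambda$; (A2) whenever $(i,j),(j,k),(k,\ell),(i,\ell)\in\Delta$, one has $(i,k)\in\Delta\Leftrightarrow(j,\ell)\in\Delta$. For $\Delta$ satisfying (A1)-(A2), $R\Delta$ is the free $R$-module with basis $\{e_{i,j} : (i,j)\in\Delta\}$, made into a (nonunital) ring by $(ae_{i,j})(be_{k,\ell})=ab\,e_{i,\ell}$ if $j=k$ and $(i,\ell)\in\Delta$, and $(ae_{i,j})(be_{k,\ell})=0$ otherwise. Adjoining $1$ gives the ring $R\cdot 1\oplus R\Delta$ (scalars from $R$ commute with the basis elements, i.e. $e_{i,j}\cdot r=r e_{i,j}$), and $G(\Delta)=\{1+x : x\in R\Delta\}$, a subgroup of its unit group. For $\Gamma\subseteq\Delta$, $R\Gamma$ is the $R$-span of the $e_{i,j}$ with $(i,j)\in\Gamma$, and $G(\Gamma)=\{1+x: x\in R\Gamma\}\subseteq G(\Delta)$. A subset $\Gamma\subseteq\Delta$ is normal if: $(i,j)\in\Gamma$, $(j,k),(i,k)\in\Delta$ imply $(i,k)\in\Gamma$; and $(i,j)\in\Gamma$, $(k,i),(k,j)\in\Delta$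 imply $(k,j)\in\Gamma$. When $\Gamma$ is normal, $G(\Gamma)$ is a normal subgroup of $G(\Delta)$ and $\Delta\setminus\Gamma$ satisfies (A1)-(A2); here $G(\Delta\setminus\Gamma)$ denotes the group $\{1+x : x\in R(\Delta\setminus\Gamma)\}$, a subgroup of the unit group of $R\cdot 1\oplus R(\Delta\setminus\Gamma)$, where $R(\Delta\setminus\Gamma)$ is the free $R$-module with basis $\{e_{i,j} : (i,j)\in\Delta\setminus\Gamma\}$ and multiplication determined by $\Delta\setminus\Gamma$, namely $(ae_{i,j})(be_{k,\ell})=ab\,e_{i,\ell}$ if $j=k$ and $(i,\ell)\in\Delta\setminus\Gamma$, and $(ae_{i,j})(be_{k,\ell})=0$ otherwise. *)

theory Defs
  imports "HOL-Algebra.Coset" "HOL-Algebra.Ring"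
begin

definition delta_axioms :: "'l set \<Rightarrow> ('l \<times> 'l) set \<Rightarrow> bool" where
  "delta_axioms \<Lambda> \<Delta> \<longleftrightarrow>
     (\<forall>i\<in>\<Lambda>. (i, i) \<notin> \<Delta>) \<and>
     (\<forall>i\<in>\<Lambda>. \<forall>j\<in>\<Lambda>. \<forall>k\<in>\<Lambda>. \<forall>l\<in>\<Lambda>.
        (i, j) \<in> \<Delta> \<longrightarrow> (j, k) \<in> \<Delta> \<longrightarrow> (k, l) \<in> \<Delta> \<longrightarrow> (i, l) \<in> \<Delta> \<longrightarrow>
        ((i, k) \<in> \<Delta> \<longleftrightarrow> (j, l) \<in> \<Delta>))"

definition normal_subset :: "('l \<times> 'l) set \<Rightarrow> ('l \<times> 'l) set \<Rightarrow> bool" where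
  "normal_subset \<Gamma> \<Delta> \<longleftrightarrow>
     \<Gamma> \<subseteq> \<Delta> \<and>
     (\<forall>i j k. (i, j) \<in> \<Gamma> \<longrightarrow> (j, k) \<in> \<Delta> \<longrightarrow> (i, k) \<in> \<Delta> \<longrightarrow> (i, k) \<in> \<Gamma>) \<and>
     (\<forall>i j k. (i, j) \<in> \<Gamma> \<longrightarrow> (k, i) \<in> \<Delta> \<longrightarrow> (k, j) \<in> \<Delta> \<longrightarrow> (k, j) \<in> \<Gamma>)"

text \<open>
  An element of the free \<open>R\<close>-module on the \<open>e\<^sub>p\<close>, \<open>p \<in> \<Delta>\<close>, is its finitely supported
  coefficient function, extended by zero outside \<open>\<Delta>\<close>. For \<open>\<Gamma> \<subseteq> \<Delta>\<close> the span of the \<open>e\<^sub>p\<close>,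
  \<open>p \<in> \<Gamma>\<close>, is then literally a subset of the module for \<open>\<Delta>\<close>.
\<close>

definition free_mod :: "('a, 'm) ring_scheme \<Rightarrow> ('l \<times> 'l) set \<Rightarrow> ('l \<times> 'l \<Rightarrow> 'a) set" where
  "free_mod R \<Delta> =
     {x. (\<forall>p. x p \<in> carrier R) \<and> (\<forall>p. p \<notin> \<Delta> \<longrightarrow> x p = \<zero>\<^bsub>R\<^esub>) \<and> finite {p. x p \<noteq> \<zero>\<^bsub>R\<^esub>}}"

text \<open>\<open>None\<close> stands for the product zero.\<close>

definition basis_mult :: "('l \<times> 'l) set \<Rightarrow> 'l \<times> 'l \<Rightarrow> 'l \<times> 'l \<Rightarrow> ('l \<times> 'l) option" where
  "basis_mult \<Delta> p q =
     (if snd p = fst q \<and> (fst p, snd q) \<in> \<Delta> then Some (fst p, snd q) else None)"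

text \<open>
  Biadditive extension of \<open>(a e\<^sub>p) (b e\<^sub>q) = (a b) (e\<^sub>p e\<^sub>q)\<close>: the coefficient at \<open>r\<close> collects
  the finitely many pairs \<open>(p, q)\<close> from the two supports with \<open>e\<^sub>p e\<^sub>q = e\<^sub>r\<close>.
\<close>

definition delta_mult ::
  "('a, 'm) ring_scheme \<Rightarrow> ('l \<times> 'l) set \<Rightarrow> ('l \<times> 'l \<Rightarrow> 'a) \<Rightarrow> ('l \<times> 'l \<Rightarrow> 'a) \<Rightarrow> 'l \<times> 'l \<Rightarrow> 'a" where
  "delta_mult R \<Delta> x y r =
     (\<Oplus>\<^bsub>R\<^esub>pq \<in> {(p, q). x p \<noteq> \<zero>\<^bsub>R\<^esub> \<and> y q \<noteq> \<zero>\<^bsub>R\<^esub> \<and> basis_mult \<Delta> p q = Some r}.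
        x (fst pq) \<otimes>\<^bsub>R\<^esub> y (snd pq))"

text \<open>
  The ring \<open>R\<cdot>1 \<oplus> R\<Delta>\<close>; the pair \<open>(r, x)\<close> is \<open>r\<cdot>1 + x\<close>. Since scalars commute with
  the basis elements, \<open>(a e\<^sub>p) s = (a s) e\<^sub>p\<close>, so the cross terms are \<open>r y\<close> and \<open>x s\<close>, taken
  coefficientwise.
\<close>

definition adj_ring ::
  "('a, 'm) ring_scheme \<Rightarrow> ('l \<times> 'l) set \<Rightarrow> ('a \<times> ('l \<times> 'l \<Rightarrow> 'a)) ring" where
  "adj_ring R \<Delta> =
     \<lparr>carrier = carrier R \<times> free_mod R \<Delta>,
      monoid.mult = (\<lambda>(r, x) (s, y).
        (r \<otimes>\<^bsub>R\<^esub> s,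
         \<lambda>p. r \<otimes>\<^bsub>R\<^esub> y p \<oplus>\<^bsub>R\<^esub> x p \<otimes>\<^bsub>R\<^esub> s \<oplus>\<^bsub>R\<^esub> delta_mult R \<Delta> x y p)),
      one = (\<one>\<^bsub>R\<^esub>, \<lambda>_. \<zero>\<^bsub>R\<^esub>),
      zero = (\<zero>\<^bsub>R\<^esub>, \<lambda>_. \<zero>\<^bsub>R\<^esub>),
      add = (\<lambda>(r, x) (s, y). (r \<oplus>\<^bsub>R\<^esub> s, \<lambda>p. x p \<oplus>\<^bsub>R\<^esub> y p))\<rparr>"

text \<open>The set of all \<open>1 + x\<close> with \<open>x\<close> in the span of the \<open>e\<^sub>p\<close>, \<open>p \<in> \<Gamma>\<close>.\<close>

definition G_set :: "('a, 'm) ring_scheme \<Rightarrow> ('l \<times> 'l) set \<Rightarrow> ('a \<times> ('l \<times> 'l \<Rightarrow> 'a)) set" where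
  "G_set R \<Gamma> = {(\<one>\<^bsub>R\<^esub>, x) |x. x \<in> free_mod R \<Gamma>}"

definition G_group ::
  "('a, 'm) ring_scheme \<Rightarrow> ('l \<times> 'l) set \<Rightarrow> ('a \<times> ('l \<times> 'l \<Rightarrow> 'a)) monoid" where
  "G_group R \<Delta> = (units_of (adj_ring R \<Delta>))\<lparr>carrier := G_set R \<Delta>\<rparr>"

text \<open>Sanity check: the multiplication does what it should on multiples of basis elements.\<close>

lemma (in ring) delta_mult_single:
  assumes "a \<in> carrier R" "b \<in> carrier R"
  shows "delta_mult R \<Delta> ((\<lambda>_. \<zero>)((i, j) := a)) ((\<lambda>_. \<zero>)((k, l) := b)) =
    (if j = k \<and> (i, l) \<in> \<Delta> then (\<lambda>_. \<zero>)((i, l) := a \<otimes> b) else (\<lambda>_. \<zero>))"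
proof
  fix r
  let ?x = "(\<lambda>_. \<zero>)((i, j) := a)" and ?y = "(\<lambda>_. \<zero>)((k, l) := b)"
  let ?S = "{(p, q). ?x p \<noteq> \<zero> \<and> ?y q \<noteq> \<zero> \<and> basis_mult \<Delta> p q = Some r}"
  have S: "?S = (if a \<noteq> \<zero> \<and> b \<noteq> \<zero> \<and> j = k \<and> (i, l) \<in> \<Delta> \<and> r = (i, l) then {((i, j), (k, l))} else {})"
    by (auto simp: basis_mult_def split: if_splits)
  show "delta_mult R \<Delta> ?x ?y r =
    (if j = k \<and> (i, l) \<in> \<Delta> then (\<lambda>_. \<zero>)((i, l) := a \<otimes> b) else (\<lambda>_. \<zero>)) r"
    unfolding delta_mult_def S using assms by (auto simp: finsum_insert)
qed

end

theory Submission imports Defs begin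

text \<open>
  Forgetting the coefficients in \<open>\<Gamma>\<close> maps \<open>G(\<Delta>)\<close> onto \<open>G(\<Delta> \<setminus> \<Gamma>)\<close>: by normality a product
  \<open>e\<^sub>p e\<^sub>q\<close> whose value lies outside \<open>\<Gamma>\<close> has both factors outside \<open>\<Gamma>\<close>. The kernel is \<open>G(\<Gamma>)\<close>, so
  the first isomorphism theorem applies once \<open>G(\<Delta>)\<close> is known to be a group. Associativity is
  (A2). For inverses, fix the finite vertex set \<open>V\<close> of the support of \<open>x\<close> and give \<open>(i, k)\<close> the
  level \<open>card {b \<in> V. (i, b) \<in> \<Delta> \<and> (b, k) \<in> \<Delta>}\<close>. By (A1) and (A2) the level of a nonzero
  product strictly exceeds that of the factors, and it is at most \<open>card V\<close>. Hence
  \<open>(1 - x)(1 + x) = 1 - x\<^sup>2\<close> reduces the inversion of \<open>1 + x\<close> to strictly higher levels.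
\<close>

section \<open>Interchange of finite sums\<close>

lemma (in abelian_monoid) finsum_swap:
  assumes "finite A" "finite B" "\<And>i j. i \<in> A \<Longrightarrow> j \<in> B \<Longrightarrow> f i j \<in> carrier G"
  shows "(\<Oplus>i\<in>A. \<Oplus>j\<in>B. f i j) = (\<Oplus>j\<in>B. \<Oplus>i\<in>A. f i j)"
  using assms(1,3)
proof (induction rule: finite_induct)
  case empty
  then show ?case by simp
next
  case (insert a A)
  have "(\<Oplus>i\<in>insert a A. \<Oplus>j\<in>B. f i j) = (\<Oplus>j\<in>B. f a j) \<oplus> (\<Oplus>j\<in>B. \<Oplus>i\<in>A. f i j)"
    using insert by (subst finsum_insert) (auto intro!: finsum_closed)
  also have "\<dots> = (\<Oplus>j\<in>B. f a j \<oplus> (\<Oplus>i\<in>A. f i j))"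
    using insert.prems by (subst finsum_addf) (auto intro!: finsum_closed)
  also have "\<dots> = (\<Oplus>j\<in>B. \<Oplus>i\<in>insert a A. f i j)"
    using insert by (intro finsum_cong') (auto simp: finsum_insert intro!: finsum_closed)
  finally show ?case .
qed

text \<open>The axioms are stated without \<open>\<Lambda>\<close>: when \<open>\<Delta>\<close> is
  contained in \<open>\<Lambda> \<times> \<Lambda>\<close>, every index that occurs lies in
  \<open>\<Lambda>\<close> anyway. The locale is used for both \<open>\<Delta>\<close> and
  \<open>\<Delta> - \<Gamma>\<close>.\<close>

locale delta_ring = ring R for R (structure) +
  fixes \<Delta> :: "('l \<times> 'l) set"
  assumes irrefl: "(i, i) \<notin> \<Delta>"
    and A2: "(i, j) \<in> \<Delta> \<Longrightarrow> (j, k) \<in> \<Delta> \<Longrightarrow> (k, l) \<in> \<Delta> \<Longrightarrow> (i, l) \<in> \<Delta> \<Longrightarrow> (i, k) \<in> \<Delta> \<longleftrightarrow> (j, l) \<in> \<Delta>"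
begin

section \<open>Finitely supported coefficient functions\<close>

lemma free_modI:
  assumes "\<And>p. x p \<in> carrier R" "\<And>p. x p \<noteq> \<zero> \<Longrightarrow> p \<in> \<Delta>" "finite S" "\<And>p. x p \<noteq> \<zero> \<Longrightarrow> p \<in> S"
  shows "x \<in> free_mod R \<Delta>"
proof -
  have "finite {p. x p \<noteq> \<zero>}"
    using assms(4) by (intro finite_subset[OF _ assms(3)]) blast
  then show ?thesis
    using assms(1,2) unfolding free_mod_def by blast
qed

lemma free_mod_carrier: "x \<in> free_mod R \<Delta> \<Longrightarrow> x p \<in> carrier R"
  unfolding free_mod_def by blast

lemma free_mod_nz: "x \<in> free_mod R \<Delta> \<Longrightarrow> x p \<noteq> \<zero> \<Longrightarrow> p \<in> \<Delta>"
  unfolding free_mod_def by blast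

lemma free_mod_finite: "x \<in> free_mod R \<Delta> \<Longrightarrow> finite {p. x p \<noteq> \<zero>}"
  unfolding free_mod_def by blast

lemma free_mod_vertices:
  assumes "x \<in> free_mod R \<Delta>"
  obtains V where "finite V" "\<And>i j. x (i, j) \<noteq> \<zero> \<Longrightarrow> i \<in> V \<and> j \<in> V"
proof
  show "finite (fst ` {p. x p \<noteq> \<zero>} \<union> snd ` {p. x p \<noteq> \<zero>})"
    using assms by (intro finite_UnI finite_imageI free_mod_finite)
  fix i j assume "x (i, j) \<noteq> \<zero>"
  then have "(i, j) \<in> {p. x p \<noteq> \<zero>}"
    by simp
  then show "i \<in> fst ` {p. x p \<noteq> \<zero>} \<union> snd ` {p. x p \<noteq> \<zero>} \<and>
      j \<in> fst ` {p. x p \<noteq> \<zero>} \<union> snd ` {p. x p \<noteq> \<zero>}"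
    by force
qed

lemma free_mod_zero: "(\<lambda>_. \<zero>) \<in> free_mod R \<Delta>"
  by (simp add: free_mod_def)

lemma free_mod_add:
  assumes "x \<in> free_mod R \<Delta>" "y \<in> free_mod R \<Delta>"
  shows "(\<lambda>p. x p \<oplus> y p) \<in> free_mod R \<Delta>"
proof (rule free_modI)
  show "finite ({p. x p \<noteq> \<zero>} \<union> {p. y p \<noteq> \<zero>})"
    using assms by (intro finite_UnI free_mod_finite)
  show "p \<in> \<Delta>" "p \<in> {p. x p \<noteq> \<zero>} \<union> {p. y p \<noteq> \<zero>}" if "x p \<oplus> y p \<noteq> \<zero>" for p
  proof -
    have "x p \<noteq> \<zero> \<or> y p \<noteq> \<zero>"
      using that by auto
    then show "p \<in> \<Delta>" "p \<in> {p. x p \<noteq> \<zero>} \<union> {p. y p \<noteq> \<zero>}"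
      using free_mod_nz[OF assms(1), of p] free_mod_nz[OF assms(2), of p] by auto
  qed
qed (simp add: free_mod_carrier[OF assms(1)] free_mod_carrier[OF assms(2)])

lemma free_mod_minus:
  assumes "x \<in> free_mod R \<Delta>"
  shows "(\<lambda>p. \<ominus> x p) \<in> free_mod R \<Delta>"
proof (rule free_modI)
  show "finite {p. x p \<noteq> \<zero>}"
    using assms by (rule free_mod_finite)
  show "p \<in> \<Delta>" "p \<in> {p. x p \<noteq> \<zero>}" if "\<ominus> x p \<noteq> \<zero>" for p
  proof -
    have "x p \<noteq> \<zero>"
      using that by auto
    then show "p \<in> \<Delta>" "p \<in> {p. x p \<noteq> \<zero>}"
      using free_mod_nz[OF assms, of p] by auto
  qed
qed (simp add: free_mod_carrier[OF assms])

section \<open>The product on the free module\<close>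

text \<open>Matrix multiplication cut off outside \<open>\<Delta>\<close>. The set \<open>V\<close>
  may be larger than the support requires, so that several products can be summed over one common
  index set.\<close>

lemma delta_mult_eq_finsum:
  assumes x: "x \<in> free_mod R \<Delta>" and y: "y \<in> free_mod R \<Delta>"
    and V: "finite V" "\<forall>i j. x (i, j) \<noteq> \<zero> \<longrightarrow> j \<in> V"
  shows "delta_mult R \<Delta> x y (i, l) = (if (i, l) \<in> \<Delta> then \<Oplus>j\<in>V. x (i, j) \<otimes> y (j, l) else \<zero>)"
proof (cases "(i, l) \<in> \<Delta>")
  case False
  then have "{(p, q). x p \<noteq> \<zero> \<and> y q \<noteq> \<zero> \<and> basis_mult \<Delta> p q = Some (i, l)} = {}"
    by (auto simp: basis_mult_def)
  then show ?thesis
    using False unfolding delta_mult_def by (simp only: finsum_empty if_False)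
next
  case True
  note [simp] = free_mod_carrier[OF x] free_mod_carrier[OF y]
  \<comment> \<open>A pair with product at \<open>(i, l)\<close> is determined by its middle vertex
    \<open>j\<close>. Enlarging \<open>?J\<close> to \<open>V\<close> adds only terms with a zero
    factor.\<close>
  let ?J = "{j. x (i, j) \<noteq> \<zero> \<and> y (j, l) \<noteq> \<zero>}" and ?h = "\<lambda>j. ((i, j), (j, l))"
  have "{(p, q). x p \<noteq> \<zero> \<and> y q \<noteq> \<zero> \<and> basis_mult \<Delta> p q = Some (i, l)} = ?h ` ?J"
    using True by (auto simp: basis_mult_def split: if_splits)
  then have "delta_mult R \<Delta> x y (i, l) = (\<Oplus>pq\<in>?h ` ?J. x (fst pq) \<otimes> y (snd pq))"
    by (simp add: delta_mult_def)
  also have "\<dots> = (\<Oplus>j\<in>?J. x (i, j) \<otimes> y (j, l))"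
    using x y by (subst add.finprod_reindex) (auto simp: inj_on_def)
  also have "\<dots> = (\<Oplus>j\<in>V. x (i, j) \<otimes> y (j, l))"
    using x y V by (intro add.finprod_mono_neutral_cong_left) auto
  finally show ?thesis
    using True by simp
qed

lemma delta_mult_closed [simp]:
  assumes x: "x \<in> free_mod R \<Delta>" and y: "y \<in> free_mod R \<Delta>"
  shows "delta_mult R \<Delta> x y p \<in> carrier R"
  unfolding delta_mult_def using free_mod_carrier[OF x] free_mod_carrier[OF y]
  by (intro finsum_closed) simp

lemma delta_mult_nz:
  assumes "delta_mult R \<Delta> x y (i, l) \<noteq> \<zero>"
  obtains j where "x (i, j) \<noteq> \<zero>" "y (j, l) \<noteq> \<zero>" "(i, l) \<in> \<Delta>"
proof -
  have "{(p, q). x p \<noteq> \<zero> \<and> y q \<noteq> \<zero> \<and> basis_mult \<Delta> p q = Some (i, l)} \<noteq> {}"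
    using assms unfolding delta_mult_def by (metis (no_types, lifting) finsum_empty)
  then show ?thesis
    using that by (auto simp: basis_mult_def split: if_splits)
qed

lemma free_mod_delta_mult:
  assumes x: "x \<in> free_mod R \<Delta>" and y: "y \<in> free_mod R \<Delta>"
  shows "delta_mult R \<Delta> x y \<in> free_mod R \<Delta>"
proof -
  obtain V where V: "finite V" "\<And>i j. x (i, j) \<noteq> \<zero> \<Longrightarrow> i \<in> V \<and> j \<in> V"
    using free_mod_vertices[OF x] by metis
  obtain W where W: "finite W" "\<And>i j. y (i, j) \<noteq> \<zero> \<Longrightarrow> i \<in> W \<and> j \<in> W"
    using free_mod_vertices[OF y] by metis
  show ?thesis
  proof (rule free_modI)
    show "finite (V \<times> W)"
      using V W by simp
    fix p assume p: "delta_mult R \<Delta> x y p \<noteq> \<zero>"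
    obtain i l where il: "p = (i, l)"
      by (cases p)
    obtain j where "x (i, j) \<noteq> \<zero>" "y (j, l) \<noteq> \<zero>" "(i, l) \<in> \<Delta>"
      using p unfolding il by (rule delta_mult_nz)
    then show "p \<in> \<Delta>" "p \<in> V \<times> W"
      using V(2) W(2) il by auto
  qed (use x y in simp)
qed

lemma delta_mult_add_left:
  assumes x: "x \<in> free_mod R \<Delta>" and y: "y \<in> free_mod R \<Delta>" and z: "z \<in> free_mod R \<Delta>"
  shows "delta_mult R \<Delta> (\<lambda>p. x p \<oplus> y p) z p = delta_mult R \<Delta> x z p \<oplus> delta_mult R \<Delta> y z p"
proof -
  note [simp] = free_mod_carrier[OF x] free_mod_carrier[OF y] free_mod_carrier[OF z]
  obtain V where V: "finite V" "\<And>i j. x (i, j) \<noteq> \<zero> \<Longrightarrow> i \<in> V \<and> j \<in> V"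
    using free_mod_vertices[OF x] by metis
  obtain W where W: "finite W" "\<And>i j. y (i, j) \<noteq> \<zero> \<Longrightarrow> i \<in> W \<and> j \<in> W"
    using free_mod_vertices[OF y] by metis
  obtain i l where p: "p = (i, l)"
    by (cases p)
  \<comment> \<open>The left factors \<open>x\<close>, \<open>y\<close> and their sum have different
    supports; the union serves all three.\<close>
  have VW: "finite (V \<union> W)" "\<forall>i j. x (i, j) \<noteq> \<zero> \<longrightarrow> j \<in> V \<union> W" "\<forall>i j. y (i, j) \<noteq> \<zero> \<longrightarrow> j \<in> V \<union> W"
    using V W by auto
  have xyVW: "\<forall>i j. x (i, j) \<oplus> y (i, j) \<noteq> \<zero> \<longrightarrow> j \<in> V \<union> W"
    using VW(2,3) by (metis l_zero zero_closed)
  show ?thesis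
    unfolding p delta_mult_eq_finsum[OF x z VW(1,2)] delta_mult_eq_finsum[OF y z VW(1,3)]
      delta_mult_eq_finsum[OF free_mod_add[OF x y] z VW(1) xyVW]
    using x y z by (simp add: l_distr finsum_addf Pi_def)
qed

lemma delta_mult_add_right:
  assumes x: "x \<in> free_mod R \<Delta>" and y: "y \<in> free_mod R \<Delta>" and z: "z \<in> free_mod R \<Delta>"
  shows "delta_mult R \<Delta> x (\<lambda>p. y p \<oplus> z p) p = delta_mult R \<Delta> x y p \<oplus> delta_mult R \<Delta> x z p"
proof -
  note [simp] = free_mod_carrier[OF x] free_mod_carrier[OF y] free_mod_carrier[OF z]
  obtain V where V: "finite V" "\<forall>i j. x (i, j) \<noteq> \<zero> \<longrightarrow> j \<in> V"
    using free_mod_vertices[OF x] by metis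
  obtain i l where p: "p = (i, l)"
    by (cases p)
  show ?thesis
    unfolding p delta_mult_eq_finsum[OF x y V] delta_mult_eq_finsum[OF x z V]
      delta_mult_eq_finsum[OF x free_mod_add[OF y z] V]
    using x y z by (simp add: r_distr finsum_addf Pi_def)
qed

lemma delta_mult_minus_left:
  assumes x: "x \<in> free_mod R \<Delta>" and y: "y \<in> free_mod R \<Delta>"
  shows "delta_mult R \<Delta> (\<lambda>p. \<ominus> x p) y p = \<ominus> delta_mult R \<Delta> x y p"
proof -
  note [simp] = free_mod_carrier[OF x] free_mod_carrier[OF y]
  have "delta_mult R \<Delta> (\<lambda>p. \<ominus> x p) y p \<oplus> delta_mult R \<Delta> x y p = delta_mult R \<Delta> (\<lambda>p. \<ominus> x p \<oplus> x p) y p"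
    using x y by (simp add: delta_mult_add_left free_mod_minus)
  also have "\<dots> = \<zero>"
    using x by (simp add: l_neg delta_mult_def)
  finally show ?thesis
    using x y by (simp add: free_mod_minus minus_equality)
qed

text \<open>Both sides at \<open>(i, l)\<close> are double sums of
  \<open>x (i, j) \<otimes> y (j, k) \<otimes> z (k, l)\<close>. The left one keeps the terms with
  \<open>(i, k) \<in> \<Delta>\<close>, the right one those with
  \<open>(j, l) \<in> \<Delta>\<close>, and (A2) identifies the two conditions.\<close>

lemma delta_mult_assoc:
  assumes x: "x \<in> free_mod R \<Delta>" and y: "y \<in> free_mod R \<Delta>" and z: "z \<in> free_mod R \<Delta>"
  shows "delta_mult R \<Delta> (delta_mult R \<Delta> x y) z p = delta_mult R \<Delta> x (delta_mult R \<Delta> y z) p"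
proof -
  note [simp] = free_mod_carrier[OF x] free_mod_carrier[OF y] free_mod_carrier[OF z]
  obtain V where V: "finite V" "\<forall>i j. x (i, j) \<noteq> \<zero> \<longrightarrow> j \<in> V"
    using free_mod_vertices[OF x] by metis
  obtain W where W: "finite W" "\<forall>i j. y (i, j) \<noteq> \<zero> \<longrightarrow> j \<in> W"
    using free_mod_vertices[OF y] by metis
  obtain i l where p: "p = (i, l)"
    by (cases p)
  \<comment> \<open>A second index in the support of the product is already one in the support of
    \<open>y\<close>.\<close>
  have xyW: "\<forall>i j. delta_mult R \<Delta> x y (i, j) \<noteq> \<zero> \<longrightarrow> j \<in> W"
    using W(2) by (blast elim: delta_mult_nz)
  have c: "x q \<otimes> y r \<otimes> z s \<in> carrier R" for q r s
    using x y z by simp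
  show ?thesis
  proof (cases "(i, l) \<in> \<Delta>")
    case False
    then show ?thesis
      unfolding p delta_mult_eq_finsum[OF free_mod_delta_mult[OF x y] z W(1) xyW]
        delta_mult_eq_finsum[OF x free_mod_delta_mult[OF y z] V] by simp
  next
    case True
    \<comment> \<open>(A2) is available only if all three factors are nonzero; otherwise both sides
      vanish.\<close>
    have key: "(if (i, k) \<in> \<Delta> then x (i, j) \<otimes> y (j, k) \<otimes> z (k, l) else \<zero>) =
        (if (j, l) \<in> \<Delta> then x (i, j) \<otimes> y (j, k) \<otimes> z (k, l) else \<zero>)" for j k
    proof (cases "x (i, j) = \<zero> \<or> y (j, k) = \<zero> \<or> z (k, l) = \<zero>")
      case False
      then have "(i, j) \<in> \<Delta>" "(j, k) \<in> \<Delta>" "(k, l) \<in> \<Delta>"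
        using x y z free_mod_nz by blast+
      then show ?thesis
        using A2[of i j k l] True by simp
    qed (use x y z in auto)
    have "delta_mult R \<Delta> (delta_mult R \<Delta> x y) z (i, l) = (\<Oplus>k\<in>W. delta_mult R \<Delta> x y (i, k) \<otimes> z (k, l))"
      using True by (simp add: delta_mult_eq_finsum[OF free_mod_delta_mult[OF x y] z W(1) xyW])
    also have "\<dots> = (\<Oplus>k\<in>W. \<Oplus>j\<in>V. if (i, k) \<in> \<Delta> then x (i, j) \<otimes> y (j, k) \<otimes> z (k, l) else \<zero>)"
      using x y z V c
      by (intro finsum_cong') (auto simp: delta_mult_eq_finsum[OF x y V] finsum_ldistr Pi_def)
    also have "\<dots> = (\<Oplus>j\<in>V. \<Oplus>k\<in>W. if (i, k) \<in> \<Delta> then x (i, j) \<otimes> y (j, k) \<otimes> z (k, l) else \<zero>)"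
      using V W c by (intro finsum_swap) auto
    \<comment> \<open>With the condition exchanged by \<open>key\<close>, the inner sum over
      \<open>k\<close> becomes the coefficient of the product of \<open>y\<close> and
      \<open>z\<close> at \<open>(j, l)\<close>.\<close>
    also have "\<dots> = (\<Oplus>j\<in>V. x (i, j) \<otimes> delta_mult R \<Delta> y z (j, l))"
      unfolding key using x y z V W
      by (intro finsum_cong') (auto simp: delta_mult_eq_finsum[OF y z W] finsum_rdistr Pi_def m_assoc)
    also have "\<dots> = delta_mult R \<Delta> x (delta_mult R \<Delta> y z) (i, l)"
      using True by (simp add: delta_mult_eq_finsum[OF x free_mod_delta_mult[OF y z] V])
    finally show ?thesis
      unfolding p .
  qed
qed

section \<open>The circle operation and its inverses\<close>

text \<open>The product of \<open>1 + x\<close> and \<open>1 + y\<close> is \<open>1 + circ x y\<close>.\<close>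

definition circ :: "('l \<times> 'l \<Rightarrow> 'a) \<Rightarrow> ('l \<times> 'l \<Rightarrow> 'a) \<Rightarrow> 'l \<times> 'l \<Rightarrow> 'a" where
  "circ x y = (\<lambda>p. y p \<oplus> x p \<oplus> delta_mult R \<Delta> x y p)"

lemma free_mod_circ:
  assumes "x \<in> free_mod R \<Delta>" "y \<in> free_mod R \<Delta>"
  shows "circ x y \<in> free_mod R \<Delta>"
  unfolding circ_def using assms by (intro free_mod_add free_mod_delta_mult)

text \<open>By biadditivity both sides expand to
  \<open>x + y + z + xy + xz + yz + xyz\<close>.\<close>

lemma circ_assoc:
  assumes x: "x \<in> free_mod R \<Delta>" and y: "y \<in> free_mod R \<Delta>" and z: "z \<in> free_mod R \<Delta>"
  shows "circ (circ x y) z = circ x (circ y z)"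
proof
  note [simp] = free_mod_carrier[OF x] free_mod_carrier[OF y] free_mod_carrier[OF z]
  show "circ (circ x y) z p = circ x (circ y z) p" for p
    unfolding circ_def using x y z
    by (simp add: delta_mult_add_left delta_mult_add_right delta_mult_assoc free_mod_add
        free_mod_delta_mult a_ac)
qed

lemma circ_zero_left: "x \<in> free_mod R \<Delta> \<Longrightarrow> circ (\<lambda>_. \<zero>) x = x"
  by (simp add: circ_def delta_mult_def free_mod_carrier)

text \<open>For \<open>b\<close> in the left set, (A2) along \<open>i, j, b, l\<close> turns
  \<open>(j, l) \<in> \<Delta>\<close> into \<open>(i, b) \<in> \<Delta>\<close>. The inclusion is
  strict because \<open>j\<close> lies in the right set, while
  \<open>(j, j) \<notin> \<Delta>\<close> by (A1).\<close>

lemma level_mono: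
  assumes V: "finite V" "j \<in> V" and ij: "(i, j) \<in> \<Delta>" and jl: "(j, l) \<in> \<Delta>" and il: "(i, l) \<in> \<Delta>"
  shows "card {b \<in> V. (j, b) \<in> \<Delta> \<and> (b, l) \<in> \<Delta>} < card {b \<in> V. (i, b) \<in> \<Delta> \<and> (b, l) \<in> \<Delta>}"
proof (rule psubset_card_mono)
  have "(i, b) \<in> \<Delta>" if "(j, b) \<in> \<Delta>" "(b, l) \<in> \<Delta>" for b
    using A2[OF ij that il] jl by simp
  then show "{b \<in> V. (j, b) \<in> \<Delta> \<and> (b, l) \<in> \<Delta>} \<subset> {b \<in> V. (i, b) \<in> \<Delta> \<and> (b, l) \<in> \<Delta>}"
    using assms irrefl[of j] by blast
qed (use V in simp)

text \<open>Here \<open>m\<close> bounds the levels on the support from below, and \<open>n\<close>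
  counts the levels still to be climbed. Each step raises \<open>m\<close> and lowers
  \<open>n\<close> by one; at \<open>n = 0\<close> the bound exceeds \<open>card V\<close>, so
  \<open>x\<close> is zero.\<close>

lemma circ_left_inverse_aux:
  assumes "finite V" "x \<in> free_mod R \<Delta>"
    and "\<And>i j. x (i, j) \<noteq> \<zero> \<Longrightarrow> i \<in> V \<and> j \<in> V"
    and "\<And>i j. x (i, j) \<noteq> \<zero> \<Longrightarrow> m \<le> card {b \<in> V. (i, b) \<in> \<Delta> \<and> (b, j) \<in> \<Delta>}"
    and "card V < m + n"
  shows "\<exists>y\<in>free_mod R \<Delta>. circ y x = (\<lambda>_. \<zero>)"
  using assms(2-)
proof (induction n arbitrary: m x)
  case 0
  have "x (i, j) = \<zero>" for i j
    using 0(3)[of i j] 0(4) card_mono[OF assms(1), of "{b \<in> V. (i, b) \<in> \<Delta> \<and> (b, j) \<in> \<Delta>}"] by force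
  then have "x = (\<lambda>_. \<zero>)"
    by auto
  then show ?case
    using circ_zero_left[OF free_mod_zero] free_mod_zero by blast
next
  case (Suc n)
  note x = Suc.prems(1)
  note [simp] = free_mod_carrier[OF x]
  \<comment> \<open>These stand for \<open>1 - x\<close> and for its product with
    \<open>1 + x\<close>, which is \<open>1 - x^2\<close>.\<close>
  let ?u = "\<lambda>p. \<ominus> x p" and ?w = "\<lambda>p. \<ominus> delta_mult R \<Delta> x x p"
  have u: "?u \<in> free_mod R \<Delta>"
    using x by (rule free_mod_minus)
  have ux: "circ ?u x = ?w"
    using x by (simp add: circ_def delta_mult_minus_left r_neg)
  have w: "?w \<in> free_mod R \<Delta>"
    using x by (intro free_mod_minus free_mod_delta_mult)
  have "\<exists>y\<in>free_mod R \<Delta>. circ y ?w = (\<lambda>_. \<zero>)"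
  proof (rule Suc.IH[OF w])
    fix i l assume "?w (i, l) \<noteq> \<zero>"
    then have "delta_mult R \<Delta> x x (i, l) \<noteq> \<zero>"
      by auto
    then obtain j where j: "x (i, j) \<noteq> \<zero>" "x (j, l) \<noteq> \<zero>" "(i, l) \<in> \<Delta>"
      by (rule delta_mult_nz)
    then show "i \<in> V \<and> l \<in> V"
      using Suc.prems(2) by blast
    \<comment> \<open>Comparing with the right factor \<open>(j, l)\<close> alone suffices, as it
      too lies in the support of \<open>x\<close>.\<close>
    have "m \<le> card {b \<in> V. (j, b) \<in> \<Delta> \<and> (b, l) \<in> \<Delta>}"
      using Suc.prems(3) j by blast
    also have "\<dots> < card {b \<in> V. (i, b) \<in> \<Delta> \<and> (b, l) \<in> \<Delta>}"
      using assms(1) Suc.prems(2) j free_mod_nz[OF x] by (intro level_mono) auto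
    finally show "Suc m \<le> card {b \<in> V. (i, b) \<in> \<Delta> \<and> (b, l) \<in> \<Delta>}"
      by simp
  qed (use Suc.prems(4) in simp)
  then obtain y where "y \<in> free_mod R \<Delta>" "circ y ?w = (\<lambda>_. \<zero>)"
    by blast
  \<comment> \<open>The witness is \<open>circ y ?u\<close>: by associativity, its product with
    \<open>x\<close> is \<open>circ y ?w\<close>.\<close>
  then show ?case
    using circ_assoc[OF _ u x] ux free_mod_circ[OF _ u] by metis
qed

lemma circ_left_inverse:
  assumes "x \<in> free_mod R \<Delta>"
  shows "\<exists>y\<in>free_mod R \<Delta>. circ y x = (\<lambda>_. \<zero>)"
proof -
  obtain V where "finite V" "\<And>i j. x (i, j) \<noteq> \<zero> \<Longrightarrow> i \<in> V \<and> j \<in> V"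
    using free_mod_vertices[OF assms] by metis
  \<comment> \<open>Start at the trivial bound \<open>m = 0\<close>; the successor makes
    \<open>card V < m + n\<close> strict.\<close>
  then show ?thesis
    using circ_left_inverse_aux[of V x 0 "Suc (card V)"] assms by simp
qed

section \<open>The group structure\<close>

lemma carrier_G_group: "carrier (G_group R \<Delta>) = Pair \<one> ` free_mod R \<Delta>"
  by (auto simp: G_group_def G_set_def)

lemma one_G_group: "\<one>\<^bsub>G_group R \<Delta>\<^esub> = (\<one>, \<lambda>_. \<zero>)"
  by (simp add: G_group_def units_of_def adj_ring_def)

lemma mult_G_group:
  assumes "x \<in> free_mod R \<Delta>" "y \<in> free_mod R \<Delta>"
  shows "(\<one>, x) \<otimes>\<^bsub>G_group R \<Delta>\<^esub> (\<one>, y) = (\<one>, circ x y)"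
  using assms by (simp add: G_group_def units_of_def adj_ring_def circ_def free_mod_carrier)

text \<open>\<open>groupI\<close> asks only for left inverses, which is why
  \<open>circ_left_inverse\<close> is one-sided.\<close>

lemma group_G_group: "group (G_group R \<Delta>)"
proof (rule groupI)
  show "\<exists>b\<in>carrier (G_group R \<Delta>). b \<otimes>\<^bsub>G_group R \<Delta>\<^esub> a = \<one>\<^bsub>G_group R \<Delta>\<^esub>"
    if "a \<in> carrier (G_group R \<Delta>)" for a
    using that circ_left_inverse by (fastforce simp: carrier_G_group one_G_group mult_G_group)
next
  fix a b assume a: "a \<in> carrier (G_group R \<Delta>)" and b: "b \<in> carrier (G_group R \<Delta>)"
  then show "a \<otimes>\<^bsub>G_group R \<Delta>\<^esub> b \<in> carrier (G_group R \<Delta>)"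
    by (auto simp: carrier_G_group mult_G_group free_mod_circ)
  fix c assume c: "c \<in> carrier (G_group R \<Delta>)"
  show "a \<otimes>\<^bsub>G_group R \<Delta>\<^esub> b \<otimes>\<^bsub>G_group R \<Delta>\<^esub> c = a \<otimes>\<^bsub>G_group R \<Delta>\<^esub> (b \<otimes>\<^bsub>G_group R \<Delta>\<^esub> c)"
    using a b c by (auto simp: carrier_G_group mult_G_group free_mod_circ circ_assoc)
qed (auto simp: carrier_G_group one_G_group mult_G_group free_mod_zero circ_zero_left)

end

section \<open>Passing from \<open>\<Delta>\<close> to \<open>\<Delta> - \<Gamma>\<close>\<close>

text \<open>If \<open>(i, k)\<close> or \<open>(j, l)\<close> were in \<open>\<Gamma>\<close>,
  multiplying by \<open>(k, l)\<close> on the right or by \<open>(i, j)\<close> on the left would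
  put \<open>(i, l)\<close> in \<open>\<Gamma>\<close>. So removing \<open>\<Gamma>\<close> affects
  neither side of the equivalence in (A2).\<close>

lemma normal_subset_Diff:
  assumes "delta_ring R \<Delta>" "normal_subset \<Gamma> \<Delta>"
  shows "delta_ring R (\<Delta> - \<Gamma>)"
proof -
  interpret delta_ring R \<Delta>
    by fact
  show ?thesis
  proof
    fix i j k l
    assume *: "(i, j) \<in> \<Delta> - \<Gamma>" "(j, k) \<in> \<Delta> - \<Gamma>" "(k, l) \<in> \<Delta> - \<Gamma>" "(i, l) \<in> \<Delta> - \<Gamma>"
    have "(j, l) \<notin> \<Gamma>"
      using * assms(2) unfolding normal_subset_def by blast
    moreover have "(i, k) \<notin> \<Gamma>"
      using * assms(2) unfolding normal_subset_def by blast
    ultimately show "(i, k) \<in> \<Delta> - \<Gamma> \<longleftrightarrow> (j, l) \<in> \<Delta> - \<Gamma>"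
      using A2[of i j k l] * by blast
  qed (simp add: irrefl)
qed

text \<open>The projection modulo the span of the basis elements in \<open>\<Gamma>\<close>, with
  the representative vanishing on \<open>\<Gamma>\<close> chosen in each class.\<close>

definition forget_coeffs ::
  "('a, 'm) ring_scheme \<Rightarrow> 'i set \<Rightarrow> 'r \<times> ('i \<Rightarrow> 'a) \<Rightarrow> 'r \<times> ('i \<Rightarrow> 'a)" where
  "forget_coeffs R \<Gamma> = (\<lambda>(r, x). (r, \<lambda>p. if p \<in> \<Gamma> then \<zero>\<^bsub>R\<^esub> else x p))"

lemma forget_coeffs_Pair [simp]:
  "forget_coeffs R \<Gamma> (r, x) = (r, \<lambda>p. if p \<in> \<Gamma> then \<zero>\<^bsub>R\<^esub> else x p)"
  by (simp add: forget_coeffs_def)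

context delta_ring
begin

lemma free_mod_forget:
  assumes "x \<in> free_mod R \<Delta>"
  shows "(\<lambda>p. if p \<in> \<Gamma> then \<zero> else x p) \<in> free_mod R (\<Delta> - \<Gamma>)"
proof -
  have "finite {p. (if p \<in> \<Gamma> then \<zero> else x p) \<noteq> \<zero>}"
    by (rule finite_subset[OF _ free_mod_finite[OF assms]]) auto
  then show ?thesis
    using assms unfolding free_mod_def by simp
qed

text \<open>On \<open>\<Gamma>\<close> the truncated product has no terms. Off
  \<open>\<Gamma>\<close>, normality shows that no contributing pair involves a forgotten
  coefficient, so the two sums coincide term by term.\<close>

lemma delta_mult_forget:
  assumes \<Gamma>: "normal_subset \<Gamma> \<Delta>" and x: "x \<in> free_mod R \<Delta>" and y: "y \<in> free_mod R \<Delta>"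
  shows "delta_mult R (\<Delta> - \<Gamma>) (\<lambda>p. if p \<in> \<Gamma> then \<zero> else x p) (\<lambda>p. if p \<in> \<Gamma> then \<zero> else y p) r =
    (if r \<in> \<Gamma> then \<zero> else delta_mult R \<Delta> x y r)"
proof -
  note [simp] = free_mod_carrier[OF x] free_mod_carrier[OF y]
  let ?x = "\<lambda>p. if p \<in> \<Gamma> then \<zero> else x p" and ?y = "\<lambda>p. if p \<in> \<Gamma> then \<zero> else y p"
  let ?S' = "{(p, q). ?x p \<noteq> \<zero> \<and> ?y q \<noteq> \<zero> \<and> basis_mult (\<Delta> - \<Gamma>) p q = Some r}"
  let ?S = "{(p, q). x p \<noteq> \<zero> \<and> y q \<noteq> \<zero> \<and> basis_mult \<Delta> p q = Some r}"
  show ?thesis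
  proof (cases "r \<in> \<Gamma>")
    case True
    then have "?S' = {}"
      by (auto simp: basis_mult_def split: if_splits)
    then have "delta_mult R (\<Delta> - \<Gamma>) ?x ?y r = \<zero>"
      unfolding delta_mult_def by (simp only: finsum_empty)
    then show ?thesis
      using True by simp
  next
    case False
    have S: "p \<notin> \<Gamma> \<and> q \<notin> \<Gamma>" if pq: "(p, q) \<in> ?S" for p q
    proof -
      obtain i j l where "p = (i, j)" "q = (j, l)" "r = (i, l)" "(i, l) \<in> \<Delta>"
        using pq by (cases p; cases q) (auto simp: basis_mult_def split: if_splits)
      moreover have "p \<in> \<Delta>" "q \<in> \<Delta>"
        using pq free_mod_nz[OF x] free_mod_nz[OF y] by auto
      \<comment> \<open>If \<open>p \<in> \<Gamma>\<close>, the first closure condition would give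
        \<open>r \<in> \<Gamma>\<close>; if \<open>q \<in> \<Gamma>\<close>, the second
        would.\<close>
      ultimately show ?thesis
        using \<Gamma> False unfolding normal_subset_def by blast
    qed
    have "?S' = ?S"
    proof (intro equalityI subsetI)
      show "pq \<in> ?S" if "pq \<in> ?S'" for pq
        using that by (auto simp: basis_mult_def split: if_splits)
      show "pq \<in> ?S'" if "pq \<in> ?S" for pq
        using that S[of "fst pq" "snd pq"] False by (auto simp: basis_mult_def split: if_splits)
    qed
    then have "delta_mult R (\<Delta> - \<Gamma>) ?x ?y r = (\<Oplus>pq\<in>?S. ?x (fst pq) \<otimes> ?y (snd pq))"
      unfolding delta_mult_def by (simp only:)
    also have "\<dots> = delta_mult R \<Delta> x y r"
      unfolding delta_mult_def using S x y by (intro finsum_cong') auto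
    finally show ?thesis
      using False by simp
  qed
qed

lemma group_hom_forget_coeffs:
  assumes \<Gamma>: "normal_subset \<Gamma> \<Delta>"
  shows "group_hom (G_group R \<Delta>) (G_group R (\<Delta> - \<Gamma>)) (forget_coeffs R \<Gamma>)"
proof -
  interpret D: delta_ring R "\<Delta> - \<Gamma>"
    using normal_subset_Diff[OF delta_ring_axioms \<Gamma>] .
  have circ: "(\<lambda>p. if p \<in> \<Gamma> then \<zero> else circ x y p) =
      D.circ (\<lambda>p. if p \<in> \<Gamma> then \<zero> else x p) (\<lambda>p. if p \<in> \<Gamma> then \<zero> else y p)"
    if "x \<in> free_mod R \<Delta>" "y \<in> free_mod R \<Delta>" for x y
    using that by (auto simp: circ_def D.circ_def delta_mult_forget[OF \<Gamma>])
  have "forget_coeffs R \<Gamma> \<in> hom (G_group R \<Delta>) (G_group R (\<Delta> - \<Gamma>))"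
    by (rule homI) (auto simp: carrier_G_group D.carrier_G_group mult_G_group D.mult_G_group
        free_mod_forget circ)
  then show ?thesis
    using group_G_group D.group_G_group by (simp add: group_hom_def group_hom_axioms_def)
qed

lemma forget_coeffs_surj:
  assumes \<Gamma>: "normal_subset \<Gamma> \<Delta>"
  shows "forget_coeffs R \<Gamma> ` carrier (G_group R \<Delta>) = carrier (G_group R (\<Delta> - \<Gamma>))"
proof (intro equalityI subsetI)
  interpret D: delta_ring R "\<Delta> - \<Gamma>"
    using normal_subset_Diff[OF delta_ring_axioms \<Gamma>] .
  show "g \<in> carrier (G_group R (\<Delta> - \<Gamma>))" if "g \<in> forget_coeffs R \<Gamma> ` carrier (G_group R \<Delta>)" for g
    using that by (auto simp: carrier_G_group D.carrier_G_group free_mod_forget)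
  show "g \<in> forget_coeffs R \<Gamma> ` carrier (G_group R \<Delta>)" if g: "g \<in> carrier (G_group R (\<Delta> - \<Gamma>))" for g
  proof
    obtain x where x: "g = (\<one>, x)" "x \<in> free_mod R (\<Delta> - \<Gamma>)"
      using g by (auto simp: D.carrier_G_group)
    \<comment> \<open>Extension by zero makes \<open>g\<close> its own preimage.\<close>
    show "g = forget_coeffs R \<Gamma> g"
      using x by (auto simp: free_mod_def fun_eq_iff)
    show "g \<in> carrier (G_group R \<Delta>)"
      using x by (auto simp: carrier_G_group free_mod_def)
  qed
qed

text \<open>Forgetting yields zero exactly when \<open>x\<close> vanishes off
  \<open>\<Gamma>\<close>; as \<open>\<Gamma> \<subseteq> \<Delta>\<close>, this describes the whole
  span of \<open>\<Gamma>\<close>.\<close>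

lemma kernel_forget_coeffs:
  assumes \<Gamma>: "normal_subset \<Gamma> \<Delta>"
  shows "kernel (G_group R \<Delta>) (G_group R (\<Delta> - \<Gamma>)) (forget_coeffs R \<Gamma>) = G_set R \<Gamma>"
proof -
  interpret D: delta_ring R "\<Delta> - \<Gamma>"
    using normal_subset_Diff[OF delta_ring_axioms \<Gamma>] .
  have *: "x \<in> free_mod R \<Delta> \<and> (\<lambda>p. if p \<in> \<Gamma> then \<zero> else x p) = (\<lambda>_. \<zero>) \<longleftrightarrow> x \<in> free_mod R \<Gamma>" for x
    using \<Gamma> unfolding free_mod_def normal_subset_def fun_eq_iff mem_Collect_eq by (meson subsetD)
  show ?thesis
    by (auto simp: kernel_def carrier_G_group D.one_G_group G_set_def *[symmetric])
qed

end

theorem theorem3p7: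
  fixes R :: "('a, 'm) ring_scheme" (structure)
    and \<Lambda> :: "'l set"
    and \<Delta> \<Gamma> :: "('l \<times> 'l) set"
  assumes "ring R" and "\<one> \<noteq> \<zero>"
    and "\<Delta> \<subseteq> \<Lambda> \<times> \<Lambda>" and "delta_axioms \<Lambda> \<Delta>"
    and "normal_subset \<Gamma> \<Delta>"
  shows "G_group R \<Delta> Mod G_set R \<Gamma> \<cong> G_group R (\<Delta> - \<Gamma>)"
proof -
  \<comment> \<open>Supplies the memberships in \<open>\<Lambda>\<close> that
    \<open>delta_axioms\<close> requires and the locale omits.\<close>
  have mem: "i \<in> \<Lambda>" "j \<in> \<Lambda>" if "(i, j) \<in> \<Delta>" for i j
    using that assms(3) by auto
  have "delta_ring_axioms \<Delta>"
    using assms(4) mem unfolding delta_axioms_def delta_ring_axioms_def by meson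
  then interpret delta_ring R \<Delta>
    using assms(1) by (simp add: delta_ring_def)
  interpret group_hom "G_group R \<Delta>" "G_group R (\<Delta> - \<Gamma>)" "forget_coeffs R \<Gamma>"
    using assms(5) by (rule group_hom_forget_coeffs)
  show ?thesis
    using FactGroup_iso[OF forget_coeffs_surj[OF assms(5)]]
    by (simp only: kernel_forget_coeffs[OF assms(5)])
qed

end
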